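(* Let $n,m$ be non-negative integers and $p\geq 5$ a prime. Then \[ \nu_p\!\left(H(p^mn)-\frac{H(n)}{p^m}-\sum_{h=2}^{m-1}\sum_{k=1}^{h}\frac{B_{p^h(p-1)-2k}}{2k\,p^{h}}\binom{p^{h}(p-1)-1}{2k-1}p^{2k(m-h)}n^{2k}\right)\geq 1, \] where an empty sum is $0$.
   Context: For an integer $N\geq 0$, $H(N)=\sum_{i=1}^N\frac1i$ is the $N$-th harmonic number ($H(0)=0$). For a prime $p$ and rational $q$, $\nu_p(q)$ is the $p$-adic valuation ($\nu_p(0)=\infty$). $B_k$ is the $k$-th Bernoulli number, defined by $\frac{t}{e^t-1}=\sum_{k\geq 0}B_k\frac{t^k}{k!}$. *)

theory Defs
  imports
    "HOL-Library.Extended"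
    "HOL-Computational_Algebra.Computational_Algebra"
    "HOL-Analysis.Harmonic_Numbers"
begin

(* The library's harm lives in real normed fields, which rat is not; the p-adic valuation
   needs the rational number itself. The next lemma relates the two. *)
definition harmonic :: "nat \<Rightarrow> rat" where
  "harmonic N = (\<Sum>i=1..N. 1 / of_nat i)"

lemma of_rat_harmonic: "of_rat (harmonic N) = (harm N :: real)"
  by (simp add: harmonic_def harm_def of_rat_sum of_rat_divide field_simps)

(* fps_exp 1 - 1 has constant term 0, so it is not invertible; the library's division of power
   series over a field cancels the common factor fps_X (see bernoulli_egf).
   In this convention the value at 1 is -1/2. *)
definition bernoulli :: "nat \<Rightarrow> rat" where
  "bernoulli k = fact k * fps_nth (fps_X / (fps_exp 1 - 1)) k"

lemma bernoulli_egf: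
  "Abs_fps (\<lambda>k. bernoulli k / fact k) * (fps_exp 1 - 1) = fps_X"
proof -
  let ?E = "fps_exp 1 - 1 :: rat fps"
  have nth1: "fps_nth ?E 1 = 1" by simp
  then have E: "?E \<noteq> 0" by force
  have "subdegree ?E = 1"
    by (rule subdegreeI) (use nth1 in auto)
  then have "?E dvd fps_X"
    using E by (subst fps_dvd_iff) auto
  moreover have "Abs_fps (\<lambda>k. bernoulli k / fact k) = fps_X / ?E"
    by (simp add: bernoulli_def fps_eq_iff)
  ultimately show ?thesis by simp
qed

definition padic_val :: "nat \<Rightarrow> rat \<Rightarrow> int extended" where
  "padic_val p q =
     (if q = 0 then Pinf
      else Fin (int (multiplicity (int p) (fst (quotient_of q)))
              - int (multiplicity (int p) (snd (quotient_of q)))))"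

lemma padic_val_quotient:
  assumes "prime p" "a \<noteq> 0" "b \<noteq> 0"
  shows "padic_val p (of_int a / of_int b) =
           Fin (int (multiplicity (int p) a) - int (multiplicity (int p) b))"
proof -
  define q :: rat where "q = of_int a / of_int b"
  obtain c d where cd: "quotient_of q = (c, d)" by fastforce
  have d: "d > 0" using cd by (rule quotient_of_denom_pos)
  have q: "q = of_int c / of_int d" using cd by (rule quotient_of_div)
  have "q \<noteq> 0" using assms by (simp add: q_def)
  then have c: "c \<noteq> 0" using q by auto
  have "(of_int (a * d) :: rat) = of_int (c * b)"
    using q assms d by (simp add: q_def field_simps)
  then have eq: "a * d = c * b" by (simp only: of_int_eq_iff)
  have p: "prime_elem (int p)" using assms(1) by simp
  have "multiplicity (int p) a + multiplicity (int p) d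
      = multiplicity (int p) c + multiplicity (int p) b"
    using arg_cong[OF eq, of "multiplicity (int p)"] p assms c d
    by (simp add: prime_elem_multiplicity_mult_distrib)
  then show ?thesis
    using \<open>q \<noteq> 0\<close> cd by (simp add: padic_val_def flip: q_def)
qed

end

theory Submission
  imports Defs "HOL-Number_Theory.Number_Theory"
begin

text \<open>
  Splitting off the multiples of $p$ repeatedly turns $H(p^m n) - H(n)/p^m$ into
  $\sum_{h<m} G_h/p^h$, where $G_h$ sums $1/i$ over the $i < p^{m-h} n$ prime to $p$. By Euler,
  $1/i \equiv i^{s-1}$ modulo $p^{h+1}$ with $s = p^h(p-1)$, so $G_h$ is a power sum modulo
  $p^{h+1}$ and Faulhaber's formula expands it in Bernoulli numbers. The odd terms vanish and,
  as $p B_k$ is $p$-integral, those of degree at least $2h+2$ are divisible by $p^{h+1}$.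
  The terms $h = 0, 1$, absent from the statement, vanish modulo $p$: for $h = 1$ because
  $B_{p(p-1)-2}$ is $p$-integral.
\<close>

section \<open>Arithmetic modulo powers of \<open>p\<close> in the \<open>p\<close>-integral
  rationals\<close>

text \<open>The ideal $p^e \mathbb{Z}_{(p)}$ of the $p$-integral rationals.\<close>
definition pideal :: "nat \<Rightarrow> nat \<Rightarrow> rat set" where
  "pideal p e = {of_int a * of_nat p ^ e / of_int b | a b. \<not> int p dvd b}"

lemma pidealI:
  assumes "\<not> int p dvd b" "x = of_int a * of_nat p ^ e / of_int b"
  shows "x \<in> pideal p e"
  using assms unfolding pideal_def by blast

lemma pidealE:
  assumes "x \<in> pideal p e"
  obtains a b where "\<not> int p dvd b" "b \<noteq> 0" "x = of_int a * of_nat p ^ e / of_int b"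
  using assms unfolding pideal_def by fastforce

lemma pideal_of_int: "prime p \<Longrightarrow> int p ^ e dvd a \<Longrightarrow> of_int a \<in> pideal p e"
  by (rule pidealI[where b = 1 and a = "a div int p ^ e"])
    (auto simp: zdvd1_eq dest: prime_gt_1_nat simp flip: of_nat_power)

lemma pideal_of_nat [simp]: "prime p \<Longrightarrow> of_nat a \<in> pideal p 0"
  using pideal_of_int[of p 0 "int a"] by simp

lemma pideal_power: "prime p \<Longrightarrow> of_nat p ^ e \<in> pideal p e"
  using pideal_of_int[of p e "int p ^ e"] by simp

lemma pideal_0 [simp]: "prime p \<Longrightarrow> 0 \<in> pideal p e"
  using pideal_of_int[of p e 0] by simp

lemma pideal_add:
  assumes "prime p" "x \<in> pideal p e" "y \<in> pideal p e"
  shows "x + y \<in> pideal p e"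
proof -
  obtain a b where x: "\<not> int p dvd b" "b \<noteq> 0" "x = of_int a * of_nat p ^ e / of_int b"
    using assms(2) by (rule pidealE)
  obtain c d where y: "\<not> int p dvd d" "d \<noteq> 0" "y = of_int c * of_nat p ^ e / of_int d"
    using assms(3) by (rule pidealE)
  have "\<not> int p dvd b * d"
    using assms(1) x(1) y(1) by (simp add: prime_dvd_mult_iff)
  moreover have "x + y = of_int (a * d + c * b) * of_nat p ^ e / of_int (b * d)"
    using x y by (simp add: field_simps)
  ultimately show ?thesis by (rule pidealI)
qed

lemma pideal_mult:
  assumes "prime p" "x \<in> pideal p e" "y \<in> pideal p f"
  shows "x * y \<in> pideal p (e + f)"
proof -
  obtain a b where x: "\<not> int p dvd b" "b \<noteq> 0" "x = of_int a * of_nat p ^ e / of_int b"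
    using assms(2) by (rule pidealE)
  obtain c d where y: "\<not> int p dvd d" "d \<noteq> 0" "y = of_int c * of_nat p ^ f / of_int d"
    using assms(3) by (rule pidealE)
  have "\<not> int p dvd b * d"
    using assms(1) x(1) y(1) by (simp add: prime_dvd_mult_iff)
  moreover have "x * y = of_int (a * c) * of_nat p ^ (e + f) / of_int (b * d)"
    using x y by (simp add: field_simps power_add)
  ultimately show ?thesis by (rule pidealI)
qed

lemma pideal_mult_left:
  "prime p \<Longrightarrow> x \<in> pideal p 0 \<Longrightarrow> y \<in> pideal p e \<Longrightarrow> x * y \<in> pideal p e"
  using pideal_mult[of p x 0 y e] by simp

lemma pideal_uminus: "prime p \<Longrightarrow> x \<in> pideal p e \<Longrightarrow> - x \<in> pideal p e"
  using pideal_mult_left[of p "-1" x e] pideal_of_int[of p 0 "-1"] by simp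

lemma pideal_diff:
  "prime p \<Longrightarrow> x \<in> pideal p e \<Longrightarrow> y \<in> pideal p e \<Longrightarrow> x - y \<in> pideal p e"
  using pideal_add[of p x e "- y"] pideal_uminus by simp

lemma pideal_sum:
  assumes "prime p" "\<And>i. i \<in> A \<Longrightarrow> f i \<in> pideal p e"
  shows "sum f A \<in> pideal p e"
  using assms(2) by (induction A rule: infinite_finite_induct) (auto simp: assms(1) intro: pideal_add)

text \<open>Read from left to right, this divides a congruence modulo \<open>p ^ (e + f)\<close> by
  \<open>p ^ f\<close>, leaving one modulo \<open>p ^ e\<close>.\<close>

lemma pideal_mult_power_iff:
  assumes "prime p"
  shows "x * of_nat p ^ f \<in> pideal p (e + f) \<longleftrightarrow> x \<in> pideal p e"
proof
  assume "x * of_nat p ^ f \<in> pideal p (e + f)"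
  then obtain a b where "\<not> int p dvd b" "b \<noteq> 0"
    "x * of_nat p ^ f = of_int a * of_nat p ^ (e + f) / of_int b"
    by (rule pidealE)
  moreover have "p \<noteq> 0" using assms by auto
  ultimately show "x \<in> pideal p e"
    by (intro pidealI[of p b x a]) (auto simp: field_simps power_add)
qed (simp add: assms pideal_mult pideal_power)

lemma pideal_inverse:
  assumes "\<not> p dvd k"
  shows "1 / of_nat k \<in> pideal p 0"
  using assms by (intro pidealI[of p "int k" _ 1]) auto

text \<open>The bound on \<open>k\<close> keeps its \<open>p\<close>-part down to at most
  \<open>p ^ e\<close>, which the numerator cancels. This absorbs the denominators \<open>j\<close>
  in Faulhaber's formula.\<close>

lemma pideal_power_div:
  assumes "prime p" "0 < k" "k < p ^ Suc e"
  shows "of_nat p ^ e / of_nat k \<in> pideal p 0"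
proof -
  have "\<not> is_unit p" using assms by auto
  then obtain u where u: "k = p ^ multiplicity p k * u" "\<not> p dvd u"
    using multiplicity_decompose'[of k p] assms by auto
  define v where "v = multiplicity p k"
  have k: "k = p ^ v * u" using u v_def by simp
  have "p ^ v \<le> k" using k assms by (cases u) auto
  then have "p ^ v < p ^ Suc e" using assms by linarith
  then have "v \<le> e" using assms prime_gt_1_nat power_less_imp_less_exp by (metis less_Suc_eq_le)
  then obtain d where e: "e = v + d" using le_Suc_ex by blast
  have "p \<noteq> 0" using assms by auto
  then have "of_nat p ^ e / of_nat k = of_nat (p ^ d) * (1 / of_nat u :: rat)"
    using k e by (simp add: power_add)
  then show ?thesis
    by (simp only: ) (intro pideal_mult_left pideal_inverse pideal_of_nat assms u)
qed

text \<open>Passage from the ideals to the valuation: a denominator prime to \<open>p\<close>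
  contributes nothing, and the factor \<open>p ^ e\<close> of the numerator contributes at least
  \<open>e\<close>.\<close>

lemma padic_val_ge:
  assumes "prime p" "x \<in> pideal p e"
  shows "padic_val p x \<ge> Fin (int e)"
proof (cases "x = 0")
  case False
  obtain a b where x: "\<not> int p dvd b" "b \<noteq> 0" "x = of_int a * of_nat p ^ e / of_int b"
    using assms(2) by (rule pidealE)
  have a: "a \<noteq> 0" using x False by auto
  have p: "prime_elem (int p)" "int p \<noteq> 0" "\<not> is_unit (int p)" using assms by auto
  have "padic_val p (of_int (a * int p ^ e) / of_int b)
      = Fin (int (multiplicity (int p) (a * int p ^ e)) - int (multiplicity (int p) b))"
    by (rule padic_val_quotient) (use assms a x p in auto)
  moreover have "multiplicity (int p) b = 0" using x by (simp add: not_dvd_imp_multiplicity_0)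
  moreover have "multiplicity (int p) (a * int p ^ e) \<ge> e"
    using a p by (intro multiplicity_geI) auto
  ultimately show ?thesis using x by simp
qed (simp add: padic_val_def)

section \<open>Faulhaber's formula and the vanishing of odd Bernoulli numbers\<close>

text \<open>Faulhaber's formula, indexed by the power of \<open>N\<close>. It compares coefficients
  of degree \<open>s\<close> in X S = B (exp(N X) - 1), where \<open>S\<close> sums exp(i X) over
  \<open>i < N\<close> and \<open>B\<close> generates the Bernoulli numbers.\<close>

theorem sum_powers_bernoulli:
  assumes "s > 0"
  shows "(\<Sum>i<N. of_nat i ^ (s - 1)) =
    (\<Sum>j=1..s. bernoulli (s - j) / of_nat j * of_nat ((s - 1) choose (j - 1)) * of_nat N ^ j)"
proof -
  obtain r where s: "s = Suc r" using assms by (cases s) auto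
  define B where "B = Abs_fps (\<lambda>k. bernoulli k / fact k)"
  define S where "S = (\<Sum>i<N. fps_exp (of_nat i :: rat))"
  \<comment> \<open>The factor exp(X) - 1 makes the sum telescope.\<close>
  have tele: "S * (fps_exp 1 - 1) = fps_exp (of_nat N) - 1"
    unfolding S_def by (induction N) (auto simp: algebra_simps simp flip: fps_exp_add_mult)
  have "fps_X * S = B * (fps_exp (of_nat N) - 1)"
    using bernoulli_egf tele unfolding B_def by (metis mult.assoc mult.commute)
  then have "S $ r = (B * (fps_exp (of_nat N) - 1)) $ s"
    by (metis s fps_X_mult_nth diff_Suc_1 nat.distinct(1))
  also have "\<dots> = ((fps_exp (of_nat N) - 1) * B) $ s" by (simp add: mult.commute)
  also have "\<dots> = (\<Sum>j=0..s. (of_nat N ^ j / fact j - (if j = 0 then 1 else 0)) * (bernoulli (s - j) / fact (s - j)))"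
    unfolding fps_mult_nth by (intro sum.cong) (auto simp: B_def)
  \<comment> \<open>The \<open>j = 0\<close> term drops out because exp(N X) - 1 has constant term
    0.\<close>
  also have "\<dots> = (\<Sum>j=1..s. of_nat N ^ j / fact j * (bernoulli (s - j) / fact (s - j)))"
    by (simp add: sum.atLeast_Suc_atMost)
  finally have "fact r * S $ r = (\<Sum>j=1..s. fact r * (of_nat N ^ j / fact j * (bernoulli (s - j) / fact (s - j))))"
    by (simp add: sum_distrib_left)
  also have "\<dots> = (\<Sum>j=1..s. bernoulli (s - j) / of_nat j * of_nat ((s - 1) choose (j - 1)) * of_nat N ^ j)"
  proof (intro sum.cong refl)
    fix j assume "j \<in> {1..s}"
    then obtain i where i: "j = Suc i" "i \<le> r" using s by (cases j) auto
    then show "fact r * (of_nat N ^ j / fact j * (bernoulli (s - j) / fact (s - j))) =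
      bernoulli (s - j) / of_nat j * of_nat ((s - 1) choose (j - 1)) * of_nat N ^ j"
      by (simp add: s binomial_fact field_simps)
  qed
  also have "fact r * S $ r = (\<Sum>i<N. of_nat i ^ (s - 1))"
    by (simp add: S_def fps_sum_nth sum_distrib_left s)
  finally show ?thesis .
qed

text \<open>The generating function B satisfies B(-X) = B(X) + X; in odd degree above 1 this makes
  the coefficient equal to its own negative.\<close>

lemma bernoulli_odd:
  assumes "odd k" "k > 1"
  shows "bernoulli k = 0"
proof -
  define B where "B = Abs_fps (\<lambda>k. bernoulli k / fact k)"
  define C where "C = B oo (- fps_X)"
  have C: "C $ i = (-1) ^ i * B $ i" for i
    unfolding C_def by (simp add: fps_compose_uminus')
  have "(fps_exp 1 - 1 :: rat fps) $ 1 \<noteq> 0" by simp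
  then have ne: "(fps_exp 1 - 1 :: rat fps) \<noteq> 0" by force
  have B: "B * (fps_exp 1 - 1) = fps_X" unfolding B_def by (rule bernoulli_egf)
  have "(B * (fps_exp 1 - 1)) oo (- fps_X) = fps_X oo (- fps_X)" using B by simp
  moreover have "fps_exp (1::rat) oo (- fps_X) = fps_exp (-1)"
    by (simp add: fps_compose_uminus' fps_eq_iff fps_exp_def)
  ultimately have "C * (fps_exp (-1) - 1) = - fps_X"
    by (simp add: C_def fps_compose_mult_distrib fps_compose_sub_distrib)
  \<comment> \<open>Multiplication by exp(X) turns exp(-X) - 1 into 1 - exp(X), so that the equation
    for \<open>C\<close> can be compared with the one for \<open>B\<close>.\<close>
  then have "C * (fps_exp (-1) - 1) * fps_exp 1 = - fps_X * fps_exp 1" by simp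
  moreover have "fps_exp (-1::rat) * fps_exp 1 = 1" by (simp flip: fps_exp_add_mult)
  ultimately have "C * (fps_exp 1 - 1) = fps_X * fps_exp 1"
    by (simp add: algebra_simps)
  also have "\<dots> = (B * fps_exp 1) * (fps_exp 1 - 1)" using B by (simp add: algebra_simps)
  finally have "C = B * fps_exp 1" using ne by simp
  also have "\<dots> = B + fps_X" using B by (simp add: algebra_simps)
  finally have "C $ k = B $ k + fps_X $ k" by simp
  then show ?thesis using assms by (simp add: C B_def)
qed

section \<open>Denominators of Bernoulli numbers at \<open>p\<close>\<close>

text \<open>A weak form of von Staudt-Clausen. In Faulhaber's formula at \<open>N = p\<close> the
  term \<open>j = 1\<close> is \<open>p\<close> times the \<open>k\<close>-th Bernoulli number.
  Every other term is an integer times \<open>p\<close> times an earlier Bernoulli number times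
  \<open>p ^ (j - 1) / j\<close>, where \<open>j < p ^ j\<close>.\<close>

lemma p_bernoulli_integral:
  assumes "prime p"
  shows "of_nat p * bernoulli k \<in> pideal p 0"
proof (induction k rule: less_induct)
  case (less k)
  define t where "t j = bernoulli (Suc k - j) / of_nat j * of_nat (k choose (j - 1)) * of_nat p ^ j" for j
  have "(\<Sum>i<p. of_nat i ^ k) = (\<Sum>j=1..Suc k. t j)"
    using sum_powers_bernoulli[of "Suc k" p] by (simp add: t_def)
  also have "\<dots> = t 1 + (\<Sum>j=2..Suc k. t j)"
    by (simp add: sum.atLeast_Suc_atMost numeral_2_eq_2)
  finally have "of_nat p * bernoulli k = of_nat (\<Sum>i<p. i ^ k) - (\<Sum>j=2..Suc k. t j)"
    by (simp add: t_def)
  moreover have "t j \<in> pideal p 0" if j: "j \<in> {2..Suc k}" for j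
  proof -
    obtain i where i: "j = Suc i" using j by (cases j) auto
    have "j < p ^ j" using prime_gt_1_nat[OF assms] by (intro power_gt_expt) auto
    then have "of_nat p ^ i / of_nat j \<in> pideal p 0"
      using assms i by (intro pideal_power_div) auto
    moreover have pB: "of_nat p * bernoulli (Suc k - j) \<in> pideal p 0"
      using j by (intro less.IH) auto
    ultimately have "of_nat (k choose (j - 1)) * ((of_nat p * bernoulli (Suc k - j)) * (of_nat p ^ i / of_nat j)) \<in> pideal p 0"
      using assms by (intro pideal_mult_left[OF assms pideal_of_nat] pideal_mult_left[OF assms pB])
    then show ?thesis by (simp add: t_def i mult_ac)
  qed
  ultimately show ?case
    using assms by (simp only: ) (intro pideal_diff pideal_sum pideal_of_nat)
qed

text \<open>The same expansion, now with one more factor \<open>p\<close> saved from each term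
  \<open>j >= 2\<close>: already \<open>p ^ (j - 2) / j\<close> is
  \<open>p\<close>-integral.\<close>

lemma p_bernoulli_power_sum:
  assumes "prime p" "p \<ge> 3"
  shows "of_nat p * bernoulli k - of_nat (\<Sum>i<p. i ^ k) \<in> pideal p 1"
proof -
  define t where "t j = bernoulli (Suc k - j) / of_nat j * of_nat (k choose (j - 1)) * of_nat p ^ j" for j
  have "(\<Sum>i<p. of_nat i ^ k) = (\<Sum>j=1..Suc k. t j)"
    using sum_powers_bernoulli[of "Suc k" p] by (simp add: t_def)
  also have "\<dots> = t 1 + (\<Sum>j=2..Suc k. t j)"
    by (simp add: sum.atLeast_Suc_atMost numeral_2_eq_2)
  finally have "of_nat p * bernoulli k - of_nat (\<Sum>i<p. i ^ k) = - (\<Sum>j=2..Suc k. t j)"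
    by (simp add: t_def)
  moreover have "t j \<in> pideal p 1" if j: "j \<in> {2..Suc k}" for j
  proof -
    obtain i where i: "j = Suc (Suc i)" using j by (cases j; cases "j - 1") auto
    \<comment> \<open>At \<open>j = 2\<close> this reads 2 < 3; with base 2 in place of 3 it would
      fail there.\<close>
    have "Suc (Suc i) < 3 ^ Suc i" by (induction i) auto
    also have "\<dots> \<le> p ^ Suc i" using assms by (intro power_mono) auto
    finally have "of_nat p ^ i / of_nat j \<in> pideal p 0"
      using assms i by (intro pideal_power_div) auto
    then have "of_nat p ^ i / of_nat j * of_nat p ^ 1 \<in> pideal p 1"
      using pideal_mult_power_iff[OF assms(1), of "of_nat p ^ i / of_nat j" 1 0] by simp
    then have "of_nat (k choose (j - 1)) * ((of_nat p * bernoulli (Suc k - j)) * (of_nat p ^ i / of_nat j * of_nat p ^ 1)) \<in> pideal p 1"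
      by (intro pideal_mult_left[OF assms(1) pideal_of_nat]
          pideal_mult_left[OF assms(1) p_bernoulli_integral] assms)
    then show ?thesis by (simp add: t_def i mult_ac)
  qed
  ultimately show ?thesis
    using assms by (simp only: ) (intro pideal_uminus pideal_sum)
qed

text \<open>Multiplication by $a$ permutes the residues, so the power sum $S$ satisfies $a^k S \equiv S$.\<close>
lemma bernoulli_integral:
  assumes "prime p" "p \<ge> 3" "coprime a p" "\<not> [a ^ k = 1] (mod p)"
  shows "bernoulli k \<in> pideal p 0"
proof -
  define S where "S = (\<Sum>i<p. i ^ k)"
  have inj: "inj_on (\<lambda>i. a * i mod p) {..<p}"
    using assms(3)
    by (auto simp: inj_on_def cong_mult_lcancel_nat simp flip: cong_def intro: cong_less_modulus_unique_nat)
  have "(\<lambda>i. a * i mod p) ` {..<p} = {..<p}"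
    using inj by (intro endo_inj_surj) (use assms in auto)
  then have "S = (\<Sum>i<p. (a * i mod p) ^ k)"
    unfolding S_def using inj sum.reindex[of "\<lambda>i. a * i mod p" "{..<p}" "\<lambda>i. i ^ k"] by simp
  also have "[\<dots> = (\<Sum>i<p. (a * i) ^ k)] (mod p)"
    by (intro cong_sum cong_pow) (simp add: cong_def)
  also have "(\<Sum>i<p. (a * i) ^ k) = a ^ k * S"
    by (simp add: S_def power_mult_distrib sum_distrib_left)
  finally have "[a ^ k * S = 1 * S] (mod p)" by (simp add: cong_sym_eq)
  \<comment> \<open>Were \<open>S\<close> invertible modulo \<open>p\<close>, cancelling it would
    give \<open>a ^ k\<close> congruent to 1.\<close>
  then have "\<not> coprime S p" using assms(4) cong_mult_rcancel_nat by blast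
  then have "p dvd S" using assms(1) by (meson coprime_commute prime_imp_coprime)
  then have "of_nat S \<in> pideal p 1"
    using pideal_of_int[of p 1 "int S"] assms(1) by simp
  then have "of_nat p * bernoulli k \<in> pideal p 1"
    using pideal_add[OF assms(1) p_bernoulli_power_sum[OF assms(1,2), of k]] by (fastforce simp: S_def)
  then show ?thesis
    using pideal_mult_power_iff[OF assms(1), of "bernoulli k" 1 0] by (simp add: mult.commute)
qed

section \<open>Splitting harmonic numbers by divisibility by \<open>p\<close>\<close>

text \<open>The strict bound matches the range of the power sums. The index 0 is excluded since
  \<open>p dvd 0\<close>, and so would be the endpoint \<open>N\<close> whenever
  \<open>p dvd N\<close>.\<close>

definition harmonic_coprime :: "nat \<Rightarrow> nat \<Rightarrow> rat" where
  "harmonic_coprime p N = (\<Sum>i | i < N \<and> \<not> p dvd i. 1 / of_nat i)"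

lemma harmonic_mult:
  assumes "p > 0"
  shows "harmonic (p * M) = harmonic_coprime p (p * M) + harmonic M / of_nat p"
proof -
  let ?A = "{i. i < p * M \<and> \<not> p dvd i}" and ?B = "(\<lambda>i. p * i) ` {1..M}"
  have *: "{1..p * M} = ?A \<union> ?B"
  proof (intro equalityI subsetI)
    fix i assume i: "i \<in> {1..p * M}"
    show "i \<in> ?A \<union> ?B"
    proof (cases "p dvd i")
      case True
      then obtain l where "i = p * l" by blast
      then show ?thesis using i assms by (intro UnI2 image_eqI[of _ _ l]) auto
    next
      case False
      \<comment> \<open>The endpoint \<open>p * M\<close> is a multiple of \<open>p\<close>, so the
        strict bound in \<open>?A\<close> loses nothing.\<close>
      then show ?thesis using i by (cases "i = p * M") auto
    qed
  next
    fix i assume "i \<in> ?A \<union> ?B"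
    then show "i \<in> {1..p * M}" using assms by (cases "i = 0") auto
  qed
  have "inj_on (\<lambda>i. p * i) {1..M}" using assms by (auto simp: inj_on_def)
  then have "(\<Sum>i\<in>?B. 1 / of_nat i :: rat) = harmonic M / of_nat p"
    by (simp add: sum.reindex harmonic_def sum_divide_distrib mult.commute)
  moreover have "harmonic (p * M) = (\<Sum>i\<in>?A. 1 / of_nat i) + (\<Sum>i\<in>?B. 1 / of_nat i)"
    unfolding harmonic_def * by (rule sum.union_disjoint) auto
  ultimately show ?thesis by (simp add: harmonic_coprime_def)
qed

lemma harmonic_power_mult:
  assumes "p > 0"
  shows "harmonic (p ^ m * n) - harmonic n / of_nat p ^ m =
    (\<Sum>h<m. harmonic_coprime p (p ^ (m - h) * n) / of_nat p ^ h)"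
proof (induction m)
  case (Suc m)
  have "harmonic (p ^ Suc m * n) - harmonic n / of_nat p ^ Suc m
    = harmonic_coprime p (p ^ Suc m * n) + (harmonic (p ^ m * n) - harmonic n / of_nat p ^ m) / of_nat p"
    using harmonic_mult[OF assms, of "p ^ m * n"] by (simp add: mult_ac diff_divide_distrib)
  then show ?case
    \<comment> \<open>The newly split-off sum is the summand \<open>h = 0\<close>; dividing the old
      summands by \<open>p\<close> shifts their index by one.\<close>
    unfolding Suc.IH by (subst sum.lessThan_Suc_shift) (simp add: sum_divide_distrib mult.commute)
qed simp

text \<open>Here \<open>s\<close> is the totient of \<open>p ^ Suc h\<close>, so Euler's theorem
  handles the \<open>i\<close> prime to \<open>p\<close>. For multiples of \<open>p\<close> the
  exponent \<open>s - 1\<close> is large enough for the power itself to vanish modulo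
  \<open>p ^ Suc h\<close>.\<close>

lemma harmonic_coprime_power_sum:
  assumes "prime p" "p \<ge> 3" and s: "s = p ^ h * (p - 1)"
  shows "harmonic_coprime p N - (\<Sum>i<N. of_nat i ^ (s - 1)) \<in> pideal p (Suc h)"
proof -
  have "h + 2 \<le> 3 ^ h * 2" by (induction h) auto
  also have "\<dots> \<le> s" unfolding s using assms by (intro mult_mono power_mono) auto
  finally have hs: "Suc h \<le> s - 1" and "s \<noteq> 0" by auto
  let ?A = "{i. i < N \<and> \<not> p dvd i}" and ?B = "{i. i < N \<and> p dvd i}"
  have *: "{..<N} = ?A \<union> ?B" by auto
  have "(\<Sum>i<N. of_nat i ^ (s - 1) :: rat) = (\<Sum>i\<in>?A. of_nat i ^ (s - 1)) + (\<Sum>i\<in>?B. of_nat i ^ (s - 1))"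
    unfolding * by (rule sum.union_disjoint) auto
  then have "harmonic_coprime p N - (\<Sum>i<N. of_nat i ^ (s - 1))
    = (\<Sum>i\<in>?A. 1 / of_nat i - of_nat i ^ (s - 1)) - (\<Sum>i\<in>?B. of_nat i ^ (s - 1))"
    by (simp add: harmonic_coprime_def sum_subtractf)
  moreover have "1 / of_nat i - of_nat i ^ (s - 1) \<in> pideal p (Suc h)" if "i \<in> ?A" for i
  proof -
    have "coprime p i" using that assms(1) by (intro prime_imp_coprime) auto
    then have "coprime i (p ^ Suc h)" by (intro coprime_power_right_iff[THEN iffD2] disjI1) (simp add: coprime_commute)
    then have "[i ^ totient (p ^ Suc h) = 1] (mod (p ^ Suc h))" by (rule euler_theorem)
    moreover have "totient (p ^ Suc h) = s" unfolding s by (rule totient_prime_power_Suc[OF assms(1)])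
    ultimately have "[int (i ^ s) = int 1] (mod int (p ^ Suc h))"
      by (simp only: cong_int_iff)
    then have "[int i ^ s = 1] (mod (int p ^ Suc h))" by simp
    then have "int p ^ Suc h dvd 1 - int i ^ s" by (simp add: cong_iff_dvd_diff dvd_diff_commute)
    then have *: "1 / of_nat i * of_int (1 - int i ^ s) \<in> pideal p (Suc h)"
      using that assms(1) by (intro pideal_mult_left pideal_inverse pideal_of_int) auto
    have "i \<noteq> 0" using that by (cases "i = 0") auto
    moreover obtain r where "s = Suc r" using \<open>s \<noteq> 0\<close> not0_implies_Suc by blast
    ultimately have "1 / of_nat i - of_nat i ^ (s - 1) = (1 / of_nat i * of_int (1 - int i ^ s) :: rat)"
      by (simp add: field_simps)
    with * show ?thesis by simp
  qed
  moreover have "of_nat i ^ (s - 1) \<in> pideal p (Suc h)" if "i \<in> ?B" for i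
  proof -
    have "p ^ Suc h dvd p ^ (s - 1)" using hs by (rule le_imp_power_dvd)
    also have "\<dots> dvd i ^ (s - 1)" using that by (intro dvd_power_same) simp
    finally have "int (p ^ Suc h) dvd int (i ^ (s - 1))" by (simp only: of_nat_dvd_iff)
    then have "int p ^ Suc h dvd int (i ^ (s - 1))" by (simp only: of_nat_power)
    then show ?thesis using pideal_of_int[of p "Suc h" "int (i ^ (s - 1))"] assms(1) by simp
  qed
  ultimately show ?thesis
    using assms(1) by (simp only: ) (rule pideal_diff; (rule pideal_sum)?; blast)
qed

text \<open>Of the \<open>j\<close> factors \<open>p\<close> in \<open>N ^ j\<close>, one makes the
  Bernoulli number integral, \<open>j - h - 2\<close> cancel the denominator \<open>j\<close>, and
  \<open>h + 1\<close> remain.\<close>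

lemma bernoulli_term_pideal:
  assumes "prime p" "p \<ge> 3" "p dvd N" "j \<ge> 2 * h + 2"
  shows "bernoulli l / of_nat j * of_nat c * of_nat N ^ j \<in> pideal p (Suc h)"
proof -
  obtain M where N: "N = p * M" using assms(3) by blast
  obtain i where j: "j = i + 2 + h" using assms(4) by (metis add.assoc add.commute le_Suc_ex mult_2)
  \<comment> \<open>This bounds \<open>j = i + 2 + h\<close> by \<open>2 * i + 2\<close>, hence
    below \<open>p ^ Suc i\<close>.\<close>
  have ih: "h \<le> i" using j assms(4) by simp
  have "j \<le> 2 * i + 2" using j ih by simp
  also have "2 * i + 2 < 3 ^ Suc i" by (induction i) auto
  also have "\<dots> \<le> p ^ Suc i" using assms by (intro power_mono) auto
  finally have "of_nat p ^ i / of_nat j \<in> pideal p 0"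
    using assms j by (intro pideal_power_div) auto
  then have "of_nat p ^ i / of_nat j * of_nat p ^ Suc h \<in> pideal p (0 + Suc h)"
    using assms by (simp only: pideal_mult_power_iff)
  then have "of_nat (c * M ^ j) * ((of_nat p * bernoulli l) * (of_nat p ^ i / of_nat j * of_nat p ^ Suc h))
      \<in> pideal p (Suc h)"
    by (intro pideal_mult_left[OF assms(1) pideal_of_nat]
        pideal_mult_left[OF assms(1) p_bernoulli_integral] assms) simp
  then show ?thesis by (simp add: N j power_mult_distrib power_add mult_ac)
qed

section \<open>Truncated Faulhaber sums\<close>

text \<open>The even-degree terms up to degree \<open>2 * h\<close> of Faulhaber's formula for the
  exponent \<open>p ^ h * (p - 1) - 1\<close>. At \<open>N = p ^ (m - h) * n\<close>, division by
  \<open>p ^ h\<close> gives the inner sum of the theorem.\<close>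

definition bernoulli_sum :: "nat \<Rightarrow> nat \<Rightarrow> nat \<Rightarrow> rat" where
  "bernoulli_sum p h N = (\<Sum>k=1..h. bernoulli (p ^ h * (p - 1) - 2 * k) / of_nat (2 * k)
     * of_nat ((p ^ h * (p - 1) - 1) choose (2 * k - 1)) * of_nat N ^ (2 * k))"

lemma harmonic_coprime_bernoulli_sum:
  assumes "prime p" "p \<ge> 5" "p dvd N"
  shows "harmonic_coprime p N - bernoulli_sum p h N \<in> pideal p (Suc h)"
proof -
  define s where "s = p ^ h * (p - 1)"
  define t where "t j = bernoulli (s - j) / of_nat j * of_nat ((s - 1) choose (j - 1)) * of_nat N ^ j" for j
  \<comment> \<open>The discarded odd \<open>j\<close> are at most \<open>2 * h + 1\<close>, so
    \<open>s - j\<close> is at least 3; this avoids \<open>bernoulli 1\<close>, which is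
    nonzero.\<close>
  have "2 * h + 4 \<le> 5 ^ h * 4" by (induction h) auto
  also have "\<dots> \<le> s" unfolding s_def using assms by (intro mult_mono power_mono) auto
  finally have hs: "2 * h + 4 \<le> s" .
  have "odd p" using assms prime_odd_nat by auto
  then have "even s" by (simp add: s_def)
  let ?K = "(\<lambda>k. 2 * k) ` {1..h}"
  have "inj_on (\<lambda>k. 2 * k) {1..h}" by (auto simp: inj_on_def)
  then have "bernoulli_sum p h N = sum t ?K"
    by (simp add: sum.reindex bernoulli_sum_def t_def s_def)
  moreover have "?K \<subseteq> {1..s}" using hs by auto
  ultimately have "sum t {1..s} - bernoulli_sum p h N = sum t ({1..s} - ?K)"
    by (simp add: sum_diff)
  moreover have "t j \<in> pideal p (Suc h)" if j: "j \<in> {1..s} - ?K" for j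
  proof (cases "j \<ge> 2 * h + 2")
    case True
    then show ?thesis unfolding t_def using assms by (intro bernoulli_term_pideal) auto
  next
    case False
    have "odd j"
    proof
      assume "even j"
      then obtain k where "j = 2 * k" by blast
      then show False using j False by auto
    qed
    then have "bernoulli (s - j) = 0" using False hs \<open>even s\<close> by (intro bernoulli_odd) auto
    then show ?thesis using assms by (simp add: t_def)
  qed
  ultimately have "sum t {1..s} - bernoulli_sum p h N \<in> pideal p (Suc h)"
    using assms by (simp only: ) (intro pideal_sum)
  moreover have "harmonic_coprime p N - sum t {1..s} \<in> pideal p (Suc h)"
    using harmonic_coprime_power_sum[of p s h N] assms hs sum_powers_bernoulli[of s N]
    by (simp add: s_def t_def)
  ultimately have "(harmonic_coprime p N - sum t {1..s}) + (sum t {1..s} - bernoulli_sum p h N) \<in> pideal p (Suc h)"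
    using assms by (intro pideal_add)
  then show ?thesis by simp
qed

text \<open>The only term contains the Bernoulli number of index \<open>p * (p - 1) - 2\<close>,
  which is \<open>p\<close>-integral, so the factor \<open>N ^ 2\<close> supplies
  \<open>p ^ 2\<close>.\<close>

lemma bernoulli_sum_1_pideal:
  assumes "prime p" "p \<ge> 5" "p dvd N"
  shows "bernoulli_sum p 1 N \<in> pideal p 2"
proof -
  define l where "l = p * (p - 1) - 2"
  have "5 * 1 \<le> p * (p - 1)" using assms by (intro mult_mono) auto
  then have l: "p * (p - 1) = l + 2" unfolding l_def by simp
  have two: "coprime 2 p" using assms by (simp add: prime_odd_nat)
  have "[2 ^ (p - 1) = 1] (mod p)" using euler_theorem[OF two] totient_prime[OF assms(1)] by simp
  then have "[(2 ^ (p - 1)) ^ p = 1 ^ p] (mod p)" by (rule cong_pow)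
  then have pow: "[2 ^ l * 4 = 1] (mod p)"
    using l by (simp add: mult.commute power_add flip: power_mult)
  \<comment> \<open>The witness for \<open>bernoulli_integral\<close> is \<open>a = 2\<close>:
    modulo \<open>p\<close>, \<open>2 ^ l\<close> is the inverse of 4, and \<open>p >= 5\<close>
    does not divide 4 - 1.\<close>
  have "\<not> [2 ^ l = 1] (mod p)"
  proof
    assume "[2 ^ l = 1] (mod p)"
    then have "[2 ^ l * 4 = 1 * 4] (mod p)" by (rule cong_scalar_right)
    with pow have "[4 = 1] (mod p)" by (metis cong_sym cong_trans mult_1)
    then show False using assms cong_less_modulus_unique_nat[of 4 1 p] by simp
  qed
  then have B: "bernoulli l \<in> pideal p 0" using assms two by (intro bernoulli_integral) auto
  obtain M where N: "N = p * M" using assms(3) by blast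
  have "1 / of_nat 2 \<in> pideal p 0"
    using assms by (intro pideal_inverse) (auto dest: dvd_imp_le)
  then have "of_nat ((l + 1) * M\<^sup>2) * (bernoulli l * (1 / of_nat 2 * of_nat p ^ 2)) \<in> pideal p 2"
    using assms B by (intro pideal_mult_left pideal_of_nat pideal_power)
  moreover have "bernoulli_sum p 1 N = of_nat ((l + 1) * M\<^sup>2) * (bernoulli l * (1 / of_nat 2 * of_nat p ^ 2))"
    using assms by (simp add: bernoulli_sum_def l N power_mult_distrib field_simps del: One_nat_def)
  ultimately show ?thesis by (simp only: )
qed

section \<open>Combining the levels \<open>h < m\<close>\<close>

theorem theorem3p11:
  fixes n m p :: nat
  assumes "prime p" and "p \<ge> 5"
  shows "padic_val p
           (harmonic (p ^ m * n) - harmonic n / of_nat p ^ m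
            - (\<Sum>h = 2..m - 1. \<Sum>k = 1..h.
                 bernoulli (p ^ h * (p - 1) - 2 * k) / (2 * of_nat k * of_nat p ^ h)
                 * of_nat ((p ^ h * (p - 1) - 1) choose (2 * k - 1))
                 * of_nat p ^ (2 * k * (m - h)) * of_nat n ^ (2 * k))) \<ge> Fin 1"
proof -
  define G where "G h = harmonic_coprime p (p ^ (m - h) * n)" for h
  define T where "T h = bernoulli_sum p h (p ^ (m - h) * n)" for h
  have p0: "p > 0" using assms by simp
  have div: "x / of_nat p ^ h \<in> pideal p 1" if "x \<in> pideal p (Suc h)" for x h
    using that p0 pideal_mult_power_iff[OF assms(1), of "x / of_nat p ^ h" h 1] by simp
  have "(\<Sum>k = 1..h.
                 bernoulli (p ^ h * (p - 1) - 2 * k) / (2 * of_nat k * of_nat p ^ h)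
                 * of_nat ((p ^ h * (p - 1) - 1) choose (2 * k - 1))
                 * of_nat p ^ (2 * k * (m - h)) * of_nat n ^ (2 * k)) = T h / of_nat p ^ h" for h
    unfolding T_def bernoulli_sum_def sum_divide_distrib
    by (intro sum.cong refl) (simp add: power_mult_distrib mult_ac flip: power_mult)
  then have "(\<Sum>h = 2..m - 1. \<Sum>k = 1..h.
                 bernoulli (p ^ h * (p - 1) - 2 * k) / (2 * of_nat k * of_nat p ^ h)
                 * of_nat ((p ^ h * (p - 1) - 1) choose (2 * k - 1))
                 * of_nat p ^ (2 * k * (m - h)) * of_nat n ^ (2 * k)) = (\<Sum>h = 2..m - 1. T h / of_nat p ^ h)"
    by simp
  \<comment> \<open>Padding with zeros gives both sums the range \<open>h < m\<close>. For
    \<open>m = 0\<close> the truncated \<open>m - 1\<close> is 0, and the original range is still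
    empty.\<close>
  also have "\<dots> = (\<Sum>h<m. if 2 \<le> h then T h / of_nat p ^ h else 0)"
    by (intro sum.mono_neutral_cong_left) auto
  finally have eq: "harmonic (p ^ m * n) - harmonic n / of_nat p ^ m - (\<Sum>h = 2..m - 1. \<Sum>k = 1..h.
                 bernoulli (p ^ h * (p - 1) - 2 * k) / (2 * of_nat k * of_nat p ^ h)
                 * of_nat ((p ^ h * (p - 1) - 1) choose (2 * k - 1))
                 * of_nat p ^ (2 * k * (m - h)) * of_nat n ^ (2 * k))
      = (\<Sum>h<m. G h / of_nat p ^ h - (if 2 \<le> h then T h / of_nat p ^ h else 0))"
    by (simp only: harmonic_power_mult[OF p0] G_def sum_subtractf)
  have "G h / of_nat p ^ h - (if 2 \<le> h then T h / of_nat p ^ h else 0) \<in> pideal p 1"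
    if h: "h < m" for h
  proof -
    have N: "p dvd p ^ (m - h) * n" using h by simp
    have "(G h - T h) / of_nat p ^ h \<in> pideal p 1"
      unfolding G_def T_def using assms N by (intro div harmonic_coprime_bernoulli_sum)
    then have GT: "G h / of_nat p ^ h - T h / of_nat p ^ h \<in> pideal p 1"
      by (simp add: diff_divide_distrib)
    consider "2 \<le> h" | "h = 1" | "h = 0" by linarith
    then show ?thesis
    proof cases
      case 1
      then show ?thesis using GT by simp
    next
      case 2
      \<comment> \<open>The theorem subtracts nothing at \<open>h = 1\<close>, so
        \<open>T h / p ^ h\<close> is added back, itself being 0 modulo \<open>p\<close>.\<close>
      have "T h / of_nat p ^ h \<in> pideal p 1"
        using bernoulli_sum_1_pideal[OF assms N] 2 by (intro div) (simp add: T_def numeral_2_eq_2)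
      from pideal_add[OF assms(1) GT this] show ?thesis using 2 by simp
    next
      case 3
      \<comment> \<open>At \<open>h = 0\<close> the sum \<open>T h\<close> is empty.\<close>
      then show ?thesis using GT by (simp add: T_def bernoulli_sum_def)
    qed
  qed
  then have "(\<Sum>h<m. G h / of_nat p ^ h - (if 2 \<le> h then T h / of_nat p ^ h else 0)) \<in> pideal p 1"
    using assms by (intro pideal_sum) auto
  from padic_val_ge[OF assms(1) this] show ?thesis unfolding eq by simp
qed

end
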